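(* Let $\mathbf{N}^+$ denote the set of positive integers, and fix a function $f:\mathbf{N}^+\to\mathbf{N}^+$ with $\lim_{n\to\infty}f(n)=\infty$. Then there exists a sequence $(x_n)_{n\ge1}$ in $[0,1)$ with Poissonian pair correlations such that $g(n)\le f(n)$ for all sufficiently large $n$, where $g(n)$ denotes the number of different gap lengths between neighboring elements of $x_1,\ldots,x_n$ on the torus.
   Context: The torus is identified with $[0,1)$, and $|\cdot|$ applied to a difference of two points denotes the distance from the nearest integer (so $|z|=\min(z,1-z)$ for $z\in[0,1)$). A sequence $x=(x_n)_{n\ge1}$ in $[0,1)$ has Poissonian pair correlations if for every real $s>0$, $$\lim_{N\to\infty} F_{x,N}(s)=2s,\qquad\text{where } F_{x,N}(s):=\frac1N\#\left\{1\le i\neq j\le N: |x_i-x_j|<\frac sN\right\},$$ the count being over ordered pairs $(i,j)$ with $i\ne j$. Gap lengths: for an integer $N\ge2$, let $\sigma$ be a permutation of $\{1,\ldots,N\}$ with $x_{\sigma(1)}\le\cdots\le x_{\sigma(N)}$, and set $\sigma(N+1):=\sigma(1)$. The set of different gap lengths is $$G(N):=\{r\in[0,1): r=|x_{\sigma(k+1)}-x_{\sigma(k)}|\text{ for some }k=1,\ldots,N\},$$ and $g(N):=\#G(N)$. *)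

theory Defs
  imports "HOL-Analysis.Analysis"
begin

text \<open>
  Points of the torus are represented by reals in \<open>[0,1)\<close>, and sequences
  \<open>x\<^sub>1, x\<^sub>2, \<dots>\<close> by functions on \<open>nat\<close> whose value at \<open>0\<close> is irrelevant.
\<close>

definition torus_abs :: "real \<Rightarrow> real" where
  "torus_abs z = infdist z \<int>"

lemma torus_abs_eq_min: "torus_abs z = min z (1 - z)" if "0 \<le> z" "z < 1"
proof (rule antisym)
  have "torus_abs z \<le> dist z 0" "torus_abs z \<le> dist z 1"
    unfolding torus_abs_def by (intro infdist_le; simp)+
  then show "torus_abs z \<le> min z (1 - z)"
    using that by (simp add: dist_real_def)
  have "min z (1 - z) \<le> dist z k" if "k \<in> \<int>" for k :: real
  proof -
    from \<open>k \<in> \<int>\<close> obtain m :: int where m: "k = of_int m"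
      by (elim Ints_cases)
    consider "m \<le> 0" | "m \<ge> 1" by linarith
    then have "k \<le> 0 \<or> k \<ge> 1"
      unfolding m by cases simp_all
    then show ?thesis
      using \<open>0 \<le> z\<close> \<open>z < 1\<close> by (auto simp: dist_real_def)
  qed
  then show "min z (1 - z) \<le> torus_abs z"
    unfolding torus_abs_def infdist_def by (auto intro!: cINF_greatest)
qed

definition pair_corr :: "(nat \<Rightarrow> real) \<Rightarrow> nat \<Rightarrow> real \<Rightarrow> real" where
  "pair_corr x N s =
     real (card {(i, j). i \<in> {1..N} \<and> j \<in> {1..N} \<and> i \<noteq> j \<and>
                         torus_abs (x i - x j) < s / real N}) / real N"

definition poissonian_pair_correlations :: "(nat \<Rightarrow> real) \<Rightarrow> bool" where
  "poissonian_pair_correlations x \<longleftrightarrow>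
     (\<forall>s>0. (\<lambda>N. pair_corr x N s) \<longlonglongrightarrow> 2 * s)"

definition sorting_perm :: "(nat \<Rightarrow> real) \<Rightarrow> nat \<Rightarrow> (nat \<Rightarrow> nat) \<Rightarrow> bool" where
  "sorting_perm x N \<sigma> \<longleftrightarrow> \<sigma> permutes {1..N} \<and> mono_on {1..N} (x \<circ> \<sigma>)"

definition gap_lengths_via :: "(nat \<Rightarrow> real) \<Rightarrow> nat \<Rightarrow> (nat \<Rightarrow> nat) \<Rightarrow> real set" where
  "gap_lengths_via x N \<sigma> =
     (let \<sigma>' = \<sigma>(Suc N := \<sigma> 1)
      in {r \<in> {0..<1}. \<exists>k\<in>{1..N}. r = torus_abs (x (\<sigma>' (Suc k)) - x (\<sigma>' k))})"

text \<open>
  If points coincide there are several sorting permutations. They all give the same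
  set of gap lengths (\<open>gap_lengths_eq\<close> below), so the choice made here is immaterial.
\<close>

definition gap_lengths :: "(nat \<Rightarrow> real) \<Rightarrow> nat \<Rightarrow> real set" where
  "gap_lengths x N = gap_lengths_via x N (SOME \<sigma>. sorting_perm x N \<sigma>)"

definition num_gap_lengths :: "(nat \<Rightarrow> real) \<Rightarrow> nat \<Rightarrow> nat" where
  "num_gap_lengths x N = card (gap_lengths x N)"

lemma sorting_perm_list:
  assumes "sorting_perm x N \<sigma>"
  shows "map (x \<circ> \<sigma>) [1..<Suc N] = sort (map x [1..<Suc N])"
proof (rule properties_for_sort[symmetric])
  have \<sigma>: "\<sigma> permutes {1..N}" and mono: "mono_on {1..N} (x \<circ> \<sigma>)"
    using assms by (auto simp: sorting_perm_def)
  have "mset [1..<Suc N] = mset_set {1..N}"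
    by (simp add: atLeastLessThanSuc_atLeastAtMost del: upt_Suc)
  moreover have "image_mset \<sigma> (mset_set {1..N}) = mset_set {1..N}"
    using \<sigma> by (metis image_mset_mset_set permutes_image permutes_inj_on)
  ultimately have "image_mset \<sigma> (mset [1..<Suc N]) = mset [1..<Suc N]"
    by simp
  then show "mset (map (x \<circ> \<sigma>) [1..<Suc N]) = mset (map x [1..<Suc N])"
    by (metis mset_map map_map)
  show "sorted (map (x \<circ> \<sigma>) [1..<Suc N])"
    unfolding sorted_map
    by (rule sorted_wrt_mono_rel[OF _ sorted_upt]) (use mono in \<open>auto simp: mono_on_def\<close>)
qed

lemma sorting_perm_exists: "\<exists>\<sigma>. sorting_perm x N \<sigma>"
proof -
  have "mset (sort_key x [1..<Suc N]) = mset [1..<Suc N]" by simp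
  then obtain p where p: "p permutes {..<length [1..<Suc N]}"
      "permute_list p [1..<Suc N] = sort_key x [1..<Suc N]"
    using mset_eq_permutation by metis
  have p_perm: "p permutes {..<N}" using p(1) by (simp del: upt_Suc)
  define \<sigma> where "\<sigma> k = (if k \<in> {1..N} then Suc (p (k - 1)) else k)" for k
  have bij: "bij_betw \<sigma> {1..N} {1..N}"
  proof -
    have "bij_betw (Suc \<circ> p \<circ> (\<lambda>k. k - 1)) {1..N} {1..N}"
    proof (intro bij_betw_trans)
      show "bij_betw (\<lambda>k. k - 1) {1..N} {..<N}"
        by (rule bij_betwI[where g = Suc]) auto
      show "bij_betw p {..<N} {..<N}" using p_perm by (rule permutes_imp_bij)
      show "bij_betw Suc {..<N} {1..N}"
        by (rule bij_betwI[where g = "\<lambda>k. k - 1"]) auto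
    qed
    then show ?thesis
      by (rule iffD1[OF bij_betw_cong, rotated]) (simp add: \<sigma>_def)
  qed
  have "\<sigma> permutes {1..N}"
    using bij by (rule bij_imp_permutes) (auto simp: \<sigma>_def)
  moreover have "mono_on {1..N} (x \<circ> \<sigma>)"
  proof (rule mono_onI)
    fix a b assume ab: "a \<in> {1..N}" "b \<in> {1..N}" "a \<le> b"
    have nth: "sort_key x [1..<Suc N] ! (k - 1) = \<sigma> k" if "k \<in> {1..N}" for k
    proof -
      have "p (k - 1) < N" using permutes_in_image[OF p_perm, of "k - 1"] that by auto
      then show ?thesis
        unfolding p(2)[symmetric] using that p(1)
        by (auto simp: permute_list_nth \<sigma>_def simp del: upt_Suc)
    qed
    have "sorted (map x (sort_key x [1..<Suc N]))" by simp
    from sorted_nth_mono[OF this, of "a - 1" "b - 1"] ab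
    show "(x \<circ> \<sigma>) a \<le> (x \<circ> \<sigma>) b"
      using nth[OF ab(1)] nth[OF ab(2)] by (auto simp del: upt_Suc)
  qed
  ultimately show ?thesis by (auto simp: sorting_perm_def)
qed

lemma gap_lengths_eq:
  assumes "sorting_perm x N \<sigma>"
  shows "gap_lengths x N = gap_lengths_via x N \<sigma>"
proof -
  define \<tau> where "\<tau> = (SOME \<sigma>. sorting_perm x N \<sigma>)"
  have \<tau>: "sorting_perm x N \<tau>"
    unfolding \<tau>_def by (rule someI_ex[OF sorting_perm_exists])
  have "map (x \<circ> \<tau>) [1..<Suc N] = map (x \<circ> \<sigma>) [1..<Suc N]"
    using sorting_perm_list[OF \<tau>] sorting_perm_list[OF assms] by simp
  then have eq: "x (\<tau> k) = x (\<sigma> k)" if "k \<in> {1..N}" for k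
    using that by (auto simp: map_eq_conv simp del: upt_Suc)
  have eq': "x ((\<tau>(Suc N := \<tau> 1)) k) = x ((\<sigma>(Suc N := \<sigma> 1)) k)"
    if "k \<in> {1..Suc N}" "N \<ge> 1" for k
    using that eq[of k] eq[of 1] by (cases "k = Suc N") auto
  have "gap_lengths_via x N \<tau> = gap_lengths_via x N \<sigma>"
  proof -
    have "x ((\<tau>(Suc N := \<tau> 1)) (Suc k)) = x ((\<sigma>(Suc N := \<sigma> 1)) (Suc k))"
         "x ((\<tau>(Suc N := \<tau> 1)) k) = x ((\<sigma>(Suc N := \<sigma> 1)) k)" if "k \<in> {1..N}" for k
      using that by (intro eq'; auto)+
    then show ?thesis
      unfolding gap_lengths_via_def Let_def by (auto simp del: fun_upd_apply)
  qed
  then show ?thesis by (simp add: gap_lengths_def \<tau>_def)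
qed

lemma finite_gap_lengths: "finite (gap_lengths x N)"
proof -
  have "finite (gap_lengths_via x N \<sigma>)" for \<sigma>
    unfolding gap_lengths_via_def Let_def
    by (rule finite_subset[of _ "(\<lambda>k. torus_abs (x ((\<sigma>(Suc N := \<sigma> 1)) (Suc k)) -
          x ((\<sigma>(Suc N := \<sigma> 1)) k))) ` {1..N}"])
       (auto simp del: fun_upd_apply)
  then show ?thesis by (simp add: gap_lengths_def)
qed

end

theory Submission
  imports Defs "HOL-Library.Discrete_Functions" "HOL-Real_Asymp.Real_Asymp"
begin

text \<open>
  Let \<open>\<eta>\<close> tend to infinity very slowly. For \<open>2 ^ k \<le> n < 2 ^ Suc k\<close> the point \<open>x n\<close> is placed on the grid
  of mesh \<open>2 ^ -(k + \<eta> k)\<close>, inside a stratum of length \<open>2 ^ -(k - \<eta> k)\<close>; the strata are visited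
  cyclically. As every stratum contains a point, all gaps are multiples of the mesh shorter than two
  strata, so their number is bounded in terms of \<open>\<eta> k\<close> alone.

  If the positions within the strata were random, the expected number of close pairs would be correct
  up to a proportion \<open>2 ^ -\<eta> k\<close>. This is derandomised: the positions are chosen one at a time so that
  the sum over all thresholds \<open>m\<close> of the squared deviation of the number of pairs closer than \<open>m\<close>
  meshes grows at most as much as it would on average. Each deviation then stays of the order of
  \<open>2 ^ (k / 2)\<close>, up to subexponential factors, because no stratum contains many points.
\<close>

section \<open>Distances on the torus\<close>

lemma torus_abs_le: "torus_abs z \<le> \<bar>z - of_int m\<bar>"
  unfolding torus_abs_def by (metis Ints_of_int dist_real_def infdist_le)

lemma torus_abs_attained: obtains m :: int where "torus_abs z = \<bar>z - of_int m\<bar>"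
proof -
  obtain w where "w \<in> \<int>" "infdist z \<int> = dist z w"
    using infdist_attains_inf[of "\<int>" z] closed_Ints by (metis Ints_0 empty_iff)
  then show ?thesis
    using that by (auto simp: torus_abs_def dist_real_def elim!: Ints_cases)
qed

lemma torus_abs_less_iff: "torus_abs z < t \<longleftrightarrow> (\<exists>m::int. \<bar>z - of_int m\<bar> < t)"
  by (metis order_le_less_trans torus_abs_attained torus_abs_le)

lemma torus_abs_minus_commute: "torus_abs (a - b) = torus_abs (b - a)"
proof -
  have "torus_abs (a - b) \<le> torus_abs (b - a)" for a b
  proof -
    obtain m where "torus_abs (b - a) = \<bar>(b - a) - of_int m\<bar>"
      by (rule torus_abs_attained)
    with torus_abs_le[of "a - b" "- m"] show ?thesis by simp
  qed
  then show ?thesis by (simp add: antisym)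
qed

lemma torus_abs_grid:
  assumes "a * real g \<in> \<int>" "g > 0"
  obtains j :: nat where "torus_abs a = real j / real g"
proof -
  obtain m where m: "torus_abs a = \<bar>a - of_int m\<bar>" by (rule torus_abs_attained)
  obtain b where b: "a * real g = of_int b" using assms(1) by (elim Ints_cases)
  then have "a = of_int b / real g" using assms(2) by (simp add: field_simps)
  then have "a - of_int m = of_int (b - m * int g) / real g"
    using assms(2) by (simp add: field_simps)
  then have "torus_abs a = real (nat \<bar>b - m * int g\<bar>) / real g"
    using m by (simp add: abs_divide)
  then show ?thesis using that by blast
qed

text \<open>Distances between grid points are multiples of the mesh, so a strict bound
  \<open>t\<close> may be rounded up to the next multiple. This leaves finitely many thresholds to
  control instead of a continuum.\<close>

lemma torus_abs_less_grid_iff: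
  assumes "a * real g \<in> \<int>" "g > 0"
  shows "torus_abs a < t \<longleftrightarrow> torus_abs a < of_int \<lceil>t * g\<rceil> / g"
proof -
  obtain j where j: "torus_abs a = real j / real g" using torus_abs_grid[OF assms] by blast
  have "real j < t * g \<longleftrightarrow> int j < \<lceil>t * g\<rceil>" by (simp add: less_ceiling_iff)
  also have "\<dots> \<longleftrightarrow> real j < of_int \<lceil>t * g\<rceil>" by linarith
  finally show ?thesis using assms(2) unfolding j by (simp add: pos_divide_less_eq)
qed

section \<open>Counting grid points in an arc\<close>

lemma card_int_open_interval:
  fixes a b :: real
  assumes "a < b"
  shows "finite {z::int. a < of_int z \<and> of_int z < b}"
    "real (card {z::int. a < of_int z \<and> of_int z < b}) \<le> b - a + 1"
    "real (card {z::int. a < of_int z \<and> of_int z < b}) \<ge> b - a - 1"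
proof -
  have eq: "{z::int. a < of_int z \<and> of_int z < b} = {\<lfloor>a\<rfloor> + 1..\<lceil>b\<rceil> - 1}"
    by (auto; linarith)
  show "finite {z::int. a < of_int z \<and> of_int z < b}" by (simp add: eq)
  have "\<lfloor>a\<rfloor> + 1 \<le> \<lceil>b\<rceil>" using assms by linarith
  then have "real (card {z::int. a < of_int z \<and> of_int z < b}) = of_int (\<lceil>b\<rceil> - \<lfloor>a\<rfloor> - 1)"
    by (simp add: eq)
  then show "real (card {z::int. a < of_int z \<and> of_int z < b}) \<le> b - a + 1"
    "real (card {z::int. a < of_int z \<and> of_int z < b}) \<ge> b - a - 1"
    by simp_all linarith+
qed

text \<open>Scaling by \<open>g\<close> turns the arc around \<open>p\<close> into an open interval
  of length \<open>2 * t * g\<close>; its integers, reduced modulo \<open>g\<close>, are exactly the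
  \<open>w\<close> counted. The error 1 is that of counting integers in an interval.\<close>

lemma card_grid_near:
  assumes g: "g > 0" and t: "0 < t" "t \<le> 1/2"
  shows "\<bar>real (card {w\<in>{..<g}. torus_abs (p - real w / real g) < t}) - 2 * t * real g\<bar> \<le> 1"
proof -
  let ?Z = "{z::int. p * g - t * g < of_int z \<and> of_int z < p * g + t * g}"
  let ?W = "{w\<in>{..<g}. torus_abs (p - real w / real g) < t}"
  let ?h = "\<lambda>z. nat (z mod int g)"
  have inj: "inj_on ?h ?Z"
  proof (rule inj_onI)
    fix z z' assume z: "z \<in> ?Z" "z' \<in> ?Z" and "?h z = ?h z'"
    then have "z mod int g = z' mod int g"
      using g by (metis eq_nat_nat_iff of_nat_0_less_iff pos_mod_sign)
    then have dvd: "int g dvd z - z'" by (simp add: mod_eq_dvd_iff)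
    \<comment> \<open>Here \<open>t \<le> 1/2\<close> enters: the interval is no longer than one
      turn of the torus, so no residue is hit twice.\<close>
    have "2 * (t * g) \<le> g" using t g by simp
    then have "\<bar>real_of_int z - of_int z'\<bar> < g" using z by auto
    then have "\<bar>z - z'\<bar> < int g" by linarith
    with dvd show "z = z'" using zdvd_imp_le[of "int g" "\<bar>z - z'\<bar>"] by force
  qed
  have im: "?h ` ?Z = ?W"
  proof (intro equalityI subsetI)
    fix w assume "w \<in> ?h ` ?Z"
    then obtain z where z: "z \<in> ?Z" "w = ?h z" by auto
    have w: "int w = z - int g * (z div int g)"
      using z(2) g by (simp add: minus_mult_div_eq_mod)
    have "real w = of_int z - real g * of_int (z div int g)"
      using arg_cong[OF w, of real_of_int] by simp
    then have "p - real w / real g - of_int (z div int g) = (p * g - of_int z) / g"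
      using g by (simp add: field_simps)
    moreover have "\<bar>(p * g - of_int z) / g\<bar> < t"
      using z(1) g by (auto simp: abs_less_iff field_simps)
    ultimately have "torus_abs (p - real w / real g) < t"
      unfolding torus_abs_less_iff by metis
    moreover have "w < g" using z(2) g by (simp add: nat_less_iff)
    ultimately show "w \<in> ?W" by simp
  next
    fix w assume w: "w \<in> ?W"
    then obtain m :: int where m: "\<bar>p - real w / real g - of_int m\<bar> < t"
      by (auto simp: torus_abs_less_iff)
    define z where "z = int w + int g * m"
    have "p - real w / real g - of_int m = (p * g - of_int z) / g"
      using g by (simp add: z_def field_simps)
    then have "z \<in> ?Z" using m g by (auto simp: abs_less_iff field_simps)
    moreover have "?h z = w" using w by (simp add: z_def)
    ultimately show "w \<in> ?h ` ?Z" by force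
  qed
  have "card ?W = card ?Z" using card_image[OF inj] unfolding im .
  moreover have "p * g - t * g < p * g + t * g" using g t by simp
  note card_int_open_interval(2,3)[OF this]
  ultimately show ?thesis unfolding abs_le_iff by linarith
qed

lemma card_grid_near_le:
  assumes g: "g > 0" and t: "0 < t"
  shows "real (card {w\<in>{..<g}. torus_abs (p - real w / real g) < t}) \<le> 2 * t * real g + 1"
proof (cases "t \<le> 1/2")
  case True
  then show ?thesis using card_grid_near[OF g t, of p] by linarith
next
  case False
  have "card {w\<in>{..<g}. torus_abs (p - real w / real g) < t} \<le> card {..<g}"
    by (intro card_mono) auto
  moreover have "real g \<le> 2 * t * real g"
    using False g by simp
  ultimately show ?thesis by simp
qed

section \<open>Periodic, triangular and geometric sums\<close>

lemma sum_periodic_shift: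
  fixes F :: "nat \<Rightarrow> real"
  assumes "\<And>n. F n = F (n mod c)"
  shows "sum F {a..<a + c} = sum F {..<c}"
proof (induction a)
  case (Suc a)
  have "F (a + c) = F a" using assms[of "a + c"] assms[of a] by simp
  moreover have "sum F {a..<Suc (a + c)} = F a + sum F {Suc a..<Suc (a + c)}"
    by (rule sum.atLeast_Suc_lessThan) simp
  ultimately show ?case using Suc by simp
qed (simp add: atLeast0LessThan)

text \<open>Full periods contribute their exact share and are peeled off one at a time. For the
  remaining incomplete period, both the sum and its expected value lie between 0 and the sum over a
  full period.\<close>

lemma sum_periodic:
  fixes F :: "nat \<Rightarrow> real"
  assumes F: "\<And>n. F n = F (n mod c)" "\<And>n. F n \<ge> 0" and c: "c > 0"
  shows "\<bar>sum F {a..<a + l} - real l * (sum F {..<c} / c)\<bar> \<le> sum F {..<c}"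
proof (induction l arbitrary: a rule: less_induct)
  case (less l)
  show ?case
  proof (cases "l < c")
    case True
    have "sum F {a..<a + l} \<le> sum F {a..<a + c}"
      using True F(2) by (intro sum_mono2) auto
    moreover have "0 \<le> sum F {a..<a + l}" "0 \<le> sum F {..<c}"
      using F(2) by (auto intro: sum_nonneg)
    moreover have "real l * (sum F {..<c} / c) \<le> sum F {..<c}"
      using True calculation(3) c mult_right_mono[of "real l" "real c" "sum F {..<c}"]
      by (simp add: field_simps)
    moreover have "0 \<le> real l * (sum F {..<c} / c)" using calculation(3) by simp
    ultimately show ?thesis using sum_periodic_shift[of F c a, OF F(1)] by linarith
  next
    case False
    have "sum F {a..<a + l} = sum F {a..<a + c} + sum F {a + c..<a + c + (l - c)}"
      using False by (simp add: sum.atLeastLessThan_concat)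
    moreover have "real l * (sum F {..<c} / c) = sum F {..<c} + real (l - c) * (sum F {..<c} / c)"
      using False c by (simp add: field_simps of_nat_diff)
    ultimately show ?thesis
      using less[of "l - c" "a + c"] False c sum_periodic_shift[of F c a, OF F(1)] by simp
  qed
qed

text \<open>Serves to fix the earlier index \<open>i\<close> and let \<open>n\<close> run through
  consecutive values, which visit the strata cyclically.\<close>

lemma sum_triangle_swap:
  fixes h :: "nat \<Rightarrow> nat \<Rightarrow> 'a::comm_monoid_add"
  shows "(\<Sum>n=a..<M. \<Sum>i=1..<n. h i n) = (\<Sum>i=1..<M. \<Sum>n=max a (Suc i)..<M. h i n)"
proof -
  have "(\<Sum>n=a..<M. \<Sum>i=1..<n. h i n) = (\<Sum>n=a..<M. \<Sum>i | i \<in> {1..<M} \<and> i < n. h i n)"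
    by (intro sum.cong) auto
  also have "\<dots> = (\<Sum>i=1..<M. \<Sum>n | n \<in> {a..<M} \<and> i < n. h i n)"
    by (rule sum.swap_restrict) auto
  also have "\<dots> = (\<Sum>i=1..<M. \<Sum>n=max a (Suc i)..<M. h i n)"
    by (intro sum.cong) auto
  finally show ?thesis .
qed

text \<open>Geometric sums are dominated by their last terms, so partial sums inherit the order of
  the summands. It will be applied to the number of strata per level.\<close>

lemma sum_over_power2_tendsto_0:
  fixes a :: "nat \<Rightarrow> nat"
  assumes "(\<lambda>k. real (a k) / 2 ^ k) \<longlonglongrightarrow> 0"
  shows "(\<lambda>K. real (\<Sum>k\<le>K. a k) / 2 ^ K) \<longlonglongrightarrow> 0"
proof (rule LIMSEQ_I)
  fix r :: real assume r: "r > 0"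
  \<comment> \<open>A quarter, because summing the powers of two up to \<open>2 ^ K\<close> doubles
    the bound; the other half of \<open>r\<close> is kept for the finitely many terms in
    \<open>A\<close>.\<close>
  obtain k0 where k0: "\<And>k. k \<ge> k0 \<Longrightarrow> real (a k) / 2 ^ k < r / 4"
    using order_tendstoD(2)[OF assms, of "r / 4"] r by (auto simp: eventually_sequentially)
  define A where "A = (\<Sum>k<k0. real (a k))"
  have "(\<lambda>K. A / 2 ^ K) \<longlonglongrightarrow> 0" by real_asymp
  then obtain K0 where K0: "\<And>K. K \<ge> K0 \<Longrightarrow> A / 2 ^ K < r / 2"
    using order_tendstoD(2)[of "\<lambda>K. A / 2 ^ K" 0 sequentially "r / 2"] r
    by (auto simp: eventually_sequentially)
  have "norm (real (\<Sum>k\<le>K. a k) / 2 ^ K - 0) < r" if K: "K \<ge> max k0 K0" for K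
  proof -
    have "{..K} = {..<k0} \<union> {k0..K}" using K by auto
    moreover have "sum f ({..<k0} \<union> {k0..K}) = sum f {..<k0} + sum f {k0..K}" for f :: "nat \<Rightarrow> real"
      by (rule sum.union_disjoint) auto
    ultimately have "real (\<Sum>k\<le>K. a k) = A + (\<Sum>k=k0..K. real (a k))"
      unfolding A_def by simp
    also have "(\<Sum>k=k0..K. real (a k)) \<le> (\<Sum>k=k0..K. r / 4 * 2 ^ k)"
      using k0 by (intro sum_mono) (simp add: pos_divide_less_eq less_imp_le)
    also have "\<dots> \<le> (\<Sum>k<Suc K. r / 4 * 2 ^ k)" using r by (intro sum_mono2) auto
    also have "\<dots> = r / 4 * (2 ^ Suc K - 1)"
      unfolding sum_distrib_left[symmetric] by (simp add: geometric_sum del: sum.lessThan_Suc)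
    also have "\<dots> \<le> r / 2 * 2 ^ K" using r by (simp add: algebra_simps)
    finally have "real (\<Sum>k\<le>K. a k) / 2 ^ K \<le> (A + r / 2 * 2 ^ K) / 2 ^ K"
      by (intro divide_right_mono) auto
    also have "\<dots> = A / 2 ^ K + r / 2" by (simp add: add_divide_distrib)
    finally have "real (\<Sum>k\<le>K. a k) / 2 ^ K \<le> A / 2 ^ K + r / 2" .
    moreover have "0 \<le> real (\<Sum>k\<le>K. a k) / 2 ^ K"
      by (intro divide_nonneg_nonneg of_nat_0_le_iff) simp
    moreover have "A / 2 ^ K < r / 2" using K0 K by simp
    ultimately show ?thesis unfolding real_norm_def by linarith
  qed
  then show "\<exists>no. \<forall>n\<ge>no. norm (real (\<Sum>k\<le>n. a k) / 2 ^ n - 0) < r" by blast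
qed

lemma filterlim_floor_log: "filterlim floor_log at_top sequentially"
  unfolding filterlim_at_top eventually_sequentially
  by (metis floor_log_le_iff floor_log_power)

section \<open>Gap lengths of points on a grid\<close>

text \<open>Two neighbours at distance \<open>2 / S\<close> or more would enclose a whole stratum,
  which contains a point. So each gap is \<open>j / g\<close> with \<open>j < 2 * g / S\<close>,
  hence \<open>j < L\<close>.\<close>

lemma num_gap_lengths_le:
  assumes x: "\<And>n. n \<in> {1..N} \<Longrightarrow> x n \<in> {0..<1}"
    and grid: "\<And>n. n \<in> {1..N} \<Longrightarrow> x n * real g \<in> \<int>"
    and strata: "\<And>c. c < S \<Longrightarrow> \<exists>n\<in>{1..N}. real c / real S \<le> x n \<and> x n < (real c + 1) / real S"
    and g: "g > 0" and S: "S > 0" and L: "2 * g \<le> L * S"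
  shows "num_gap_lengths x N \<le> L"
proof -
  obtain \<sigma> where \<sigma>: "sorting_perm x N \<sigma>" using sorting_perm_exists by blast
  then have perm: "\<sigma> permutes {1..N}" and mono: "mono_on {1..N} (x \<circ> \<sigma>)"
    by (auto simp: sorting_perm_def)
  have \<sigma>_in: "\<sigma> k \<in> {1..N}" if "k \<in> {1..N}" for k
    using that perm by (simp only: permutes_in_image)
  have surj: "\<exists>k\<in>{1..N}. \<sigma> k = n" if "n \<in> {1..N}" for n
    using that perm by (metis imageE permutes_image)
  have xmono: "x (\<sigma> a) \<le> x (\<sigma> b)" if "a \<in> {1..N}" "b \<in> {1..N}" "a \<le> b" for a b
    using mono_onD[OF mono that] by simp
  have step: "\<bar>x (\<sigma> (Suc k)) - x (\<sigma> k)\<bar> < 2 / S" if k: "k \<in> {1..N}" "Suc k \<in> {1..N}" for k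
  proof (rule ccontr)
    assume "\<not> ?thesis"
    then have far: "x (\<sigma> (Suc k)) \<ge> x (\<sigma> k) + 2 / S" using xmono[OF k] by simp
    let ?y = "x (\<sigma> k)"
    have y: "0 \<le> ?y" and y': "x (\<sigma> (Suc k)) < 1"
      using x[OF \<sigma>_in[OF k(1)]] x[OF \<sigma>_in[OF k(2)]] by auto
    \<comment> \<open>Stratum \<open>c\<close> is the first one that starts strictly after
      \<open>?y\<close>; it ends at most \<open>2 / S\<close> after \<open>?y\<close>.\<close>
    define c where "c = nat \<lfloor>?y * S\<rfloor> + 1"
    have c1: "?y * S < real c" and c2: "real c \<le> ?y * S + 1"
      using y by (simp_all add: c_def) linarith+
    have "(real c + 1) / S \<le> (?y * S + 2) / S" using c2 by (intro divide_right_mono) auto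
    also have "\<dots> = ?y + 2 / S" using S by (simp add: add_divide_distrib)
    finally have "(real c + 1) / S \<le> ?y + 2 / S" .
    then have c3: "(real c + 1) / S \<le> x (\<sigma> (Suc k))" using far by linarith
    then have "(real c + 1) / S < 1" using y' by linarith
    then have "c < S" using S by (simp add: field_simps)
    then obtain n where n: "n \<in> {1..N}" "real c / S \<le> x n" "x n < (real c + 1) / S"
      using strata by blast
    then obtain j where j: "j \<in> {1..N}" "\<sigma> j = n" using surj by blast
    have "?y < real c / S" using c1 S by (simp add: pos_less_divide_eq)
    then have "?y < x n" using n(2) by linarith
    moreover have "x n < x (\<sigma> (Suc k))" using n(3) c3 by linarith
    ultimately have "k < j" "j < Suc k"
      using xmono[OF j(1) k(1)] xmono[OF k(2) j(1)] j(2) by force+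
    then show False by simp
  qed
  \<comment> \<open>The gap across 0: the first and the last stratum are occupied, so the extreme
    points are each within \<open>1 / S\<close> of an integer. Adding 1 unrolls the circle.\<close>
  have wrap: "\<bar>x (\<sigma> 1) - x (\<sigma> N) + 1\<bar> < 2 / S" if "N \<ge> 1"
  proof -
    obtain n where n: "n \<in> {1..N}" "x n < 1 / S" using strata[of 0] S by auto
    then obtain j where "j \<in> {1..N}" "\<sigma> j = n" using surj by blast
    then have "x (\<sigma> 1) \<le> x n" using xmono[of 1 j] that by auto
    moreover obtain n' where n': "n' \<in> {1..N}" "real (S - 1) / S \<le> x n'"
      using strata[of "S - 1"] S by auto
    then obtain j' where "j' \<in> {1..N}" "\<sigma> j' = n'" using surj by blast
    then have "x n' \<le> x (\<sigma> N)" using xmono[of j' N] that by auto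
    moreover have "real (S - 1) / S = 1 - 1 / S" using S by (simp add: field_simps of_nat_diff)
    moreover have "0 \<le> x (\<sigma> 1)" "x (\<sigma> N) < 1"
      using x[OF \<sigma>_in[of 1]] x[OF \<sigma>_in[of N]] that by auto
    moreover have "2 / real S = 1 / S + 1 / S" by simp
    ultimately show ?thesis using n(2) n'(2) by linarith
  qed
  have sub: "gap_lengths_via x N \<sigma> \<subseteq> (\<lambda>j. real j / real g) ` {..<L}"
  proof
    fix r assume "r \<in> gap_lengths_via x N \<sigma>"
    then obtain k where k: "k \<in> {1..N}"
      and r: "r = torus_abs (x ((\<sigma>(Suc N := \<sigma> 1)) (Suc k)) - x ((\<sigma>(Suc N := \<sigma> 1)) k))"
      unfolding gap_lengths_via_def Let_def by blast
    define k' where "k' = (if k = N then 1 else Suc k)"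
    have k': "k' \<in> {1..N}" using k by (auto simp: k'_def)
    have r': "r = torus_abs (x (\<sigma> k') - x (\<sigma> k))" using r k by (auto simp: k'_def)
    have "r < 2 / S"
    proof (cases "k = N")
      case True
      then show ?thesis using wrap k torus_abs_le[of "x (\<sigma> k') - x (\<sigma> k)" "- 1"]
        by (simp add: r' k'_def)
    next
      case False
      then show ?thesis using step[of k] k torus_abs_le[of "x (\<sigma> k') - x (\<sigma> k)" 0]
        by (auto simp: r' k'_def)
    qed
    moreover have "(x (\<sigma> k') - x (\<sigma> k)) * real g \<in> \<int>"
      using grid[OF \<sigma>_in[OF k]] grid[OF \<sigma>_in[OF k']] by (simp add: left_diff_distrib)
    then obtain j where j: "r = real j / real g"
      using torus_abs_grid[OF _ g] unfolding r' by blast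
    ultimately have "real j * real S < 2 * real g" using g S by (simp add: field_simps)
    then have "real (j * S) < real (2 * g)" by simp
    then have "j * S < L * S" using L by (metis of_nat_less_iff order_less_le_trans)
    then show "r \<in> (\<lambda>j. real j / real g) ` {..<L}" using j by auto
  qed
  have "num_gap_lengths x N = card (gap_lengths_via x N \<sigma>)"
    by (simp add: num_gap_lengths_def gap_lengths_eq[OF \<sigma>])
  also have "\<dots> \<le> card ((\<lambda>j. real j / real g) ` {..<L})"
    using sub by (intro card_mono) auto
  also have "\<dots> \<le> L" using card_image_le[of "{..<L}"] by simp
  finally show ?thesis .
qed

section \<open>The greedy construction\<close>

text \<open>The value is raised by one only when \<open>Q\<close> holds for the new value from then
  on, so each positive value is safe once attained. As every \<open>Q e\<close> holds eventually,
  the raising never stops.\<close>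

lemma slow_function_exists:
  fixes Q :: "nat \<Rightarrow> nat \<Rightarrow> bool"
  assumes Q: "\<And>e. \<forall>\<^sub>F k in sequentially. Q e k"
  obtains \<eta> :: "nat \<Rightarrow> nat" where "\<eta> 0 = 0" "mono \<eta>" "\<And>k. \<eta> (Suc k) \<le> Suc (\<eta> k)"
    "filterlim \<eta> at_top sequentially" "\<forall>\<^sub>F k in sequentially. Q (\<eta> k) k"
proof -
  define \<eta> where
    "\<eta> = rec_nat 0 (\<lambda>k e. if \<forall>j\<ge>Suc k. Q (Suc e) j then Suc e else e)"
  have \<eta>0: "\<eta> 0 = 0" by (simp add: \<eta>_def)
  have \<eta>Suc: "\<eta> (Suc k) = (if \<forall>j\<ge>Suc k. Q (Suc (\<eta> k)) j then Suc (\<eta> k) else \<eta> k)" for k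
    by (simp add: \<eta>_def)
  have mono: "mono \<eta>" by (rule incseq_SucI) (simp add: \<eta>Suc)
  \<comment> \<open>The initial value 0 is taken without a check, hence the first alternative; it is
    excluded later, when \<open>\<eta>\<close> has become positive.\<close>
  have inv: "\<eta> k = 0 \<or> (\<forall>j\<ge>k. Q (\<eta> k) j)" for k
    by (induction k) (auto simp: \<eta>0 \<eta>Suc)
  have unb: "\<exists>k. \<eta> k \<ge> e" for e
  proof (induction e)
    case (Suc e)
    then obtain k where k: "\<eta> k \<ge> e" by blast
    obtain k0 where k0: "\<And>j. j \<ge> k0 \<Longrightarrow> Q (Suc e) j"
      using Q[of "Suc e"] by (auto simp: eventually_sequentially)
    let ?K = "max k k0"
    have "\<eta> ?K \<ge> e" using k monoD[OF mono, of k ?K] by simp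
    then have "\<eta> (Suc ?K) \<ge> Suc e" using k0 by (cases "\<eta> ?K = e") (auto simp: \<eta>Suc)
    then show ?case by blast
  qed simp
  have lim: "filterlim \<eta> at_top sequentially"
    unfolding filterlim_at_top eventually_sequentially
    using unb monoD[OF mono] by (meson order_trans)
  have "\<forall>\<^sub>F k in sequentially. \<eta> k \<ge> 1" using lim by (auto simp: filterlim_at_top)
  then have "\<forall>\<^sub>F k in sequentially. Q (\<eta> k) k"
    by eventually_elim (metis inv le_refl not_one_le_zero)
  then show ?thesis using that \<eta>0 mono lim by (simp add: \<eta>Suc)
qed

text \<open>Average over \<open>v < D\<close>: the centred increment has mean 0, so the cross term
  with \<open>S m\<close> vanishes and only the variance, at most the mean square of
  \<open>a m\<close>, is added. Some \<open>v\<close> does no worse than the average of the whole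
  sum over \<open>M\<close>.\<close>

lemma exists_below_average_step:
  fixes S :: "'m \<Rightarrow> real" and a :: "'m \<Rightarrow> nat \<Rightarrow> real"
  assumes D: "D > 0"
  shows "\<exists>v<D. (\<Sum>m\<in>M. (S m + (a m v - (\<Sum>w<D. a m w) / D))\<^sup>2) \<le>
    (\<Sum>m\<in>M. (S m)\<^sup>2) + (\<Sum>m\<in>M. (\<Sum>w<D. (a m w)\<^sup>2) / D)" (is "\<exists>v<D. ?L v \<le> ?R")
proof (rule ccontr)
  assume "\<not> ?thesis"
  then have "(\<Sum>v<D. ?R) < (\<Sum>v<D. ?L v)"
    using D by (intro sum_strict_mono) (auto simp: not_le)
  moreover have "(\<Sum>v<D. (S m + (a m v - (\<Sum>w<D. a m w) / D))\<^sup>2) \<le>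
      D * ((S m)\<^sup>2 + (\<Sum>w<D. (a m w)\<^sup>2) / D)" for m
  proof -
    define A where "A = (\<Sum>w<D. a m w)"
    have "(\<Sum>v<D. (S m + (a m v - A / D))\<^sup>2) =
        (\<Sum>v<D. (S m - A / D)\<^sup>2 + 2 * (S m - A / D) * a m v + (a m v)\<^sup>2)"
      by (intro sum.cong) (auto simp: power2_eq_square algebra_simps)
    also have "\<dots> = D * (S m - A / D)\<^sup>2 + 2 * (S m - A / D) * A + (\<Sum>w<D. (a m w)\<^sup>2)"
      by (simp add: sum.distrib sum_distrib_left A_def)
    also have "\<dots> = D * (S m)\<^sup>2 + (\<Sum>w<D. (a m w)\<^sup>2) - A\<^sup>2 / D"
      using D by (simp add: power2_eq_square field_simps)
    also have "\<dots> \<le> D * ((S m)\<^sup>2 + (\<Sum>w<D. (a m w)\<^sup>2) / D)"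
      using D by (simp add: distrib_left)
    finally show ?thesis by (simp add: A_def)
  qed
  then have "(\<Sum>m\<in>M. \<Sum>v<D. (S m + (a m v - (\<Sum>w<D. a m w) / D))\<^sup>2) \<le>
      (\<Sum>m\<in>M. D * ((S m)\<^sup>2 + (\<Sum>w<D. (a m w)\<^sup>2) / D))"
    by (intro sum_mono)
  then have "(\<Sum>v<D. ?L v) \<le> D * ?R"
    by (subst sum.swap) (simp add: sum.distrib sum_distrib_left distrib_left)
  ultimately show False by simp
qed

text \<open>Only indices below \<open>n\<close> are counted: each unordered pair is charged to its
  later point, whose position is chosen knowing the earlier ones.\<close>

definition near :: "(nat \<Rightarrow> real) \<Rightarrow> nat \<Rightarrow> real \<Rightarrow> real \<Rightarrow> nat" where
  "near x n t p = card {i\<in>{1..<n}. torus_abs (x i - p) < t}"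

lemma near_eq_sum: "real (near x n t p) = (\<Sum>i=1..<n. of_bool (torus_abs (x i - p) < t))"
  by (simp add: near_def of_bool_def sum.If_cases Int_def)

lemma pair_corr_eq:
  "pair_corr x N s = 2 * (\<Sum>n=1..<Suc N. real (near x n (s / N) (x n))) / N"
proof -
  let ?t = "s / real N"
  let ?L = "Sigma {1..<Suc N} (\<lambda>n. {i\<in>{1..<n}. torus_abs (x i - x n) < ?t})"
  have "finite ?L" by auto
  moreover have eq: "{(i, j). i \<in> {1..N} \<and> j \<in> {1..N} \<and> i \<noteq> j \<and> torus_abs (x i - x j) < ?t} =
      ?L \<union> prod.swap ` ?L"
    by (force simp: image_iff neq_iff torus_abs_minus_commute[of "x _" "x _"])
  moreover have "?L \<inter> prod.swap ` ?L = {}" by auto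
  moreover have "card (prod.swap ` ?L) = card ?L" by (intro card_image) (auto simp: inj_on_def)
  moreover have "card ?L = (\<Sum>n=1..<Suc N. near x n ?t (x n))"
    unfolding near_def by (intro card_SigmaI) auto
  ultimately have "card {(i, j). i \<in> {1..N} \<and> j \<in> {1..N} \<and> i \<noteq> j \<and> torus_abs (x i - x j) < ?t}
      = 2 * (\<Sum>n=1..<Suc N. near x n ?t (x n))"
    unfolding eq by (subst card_Un_disjoint) (simp_all only: finite_imageI mult_2)
  then show ?thesis unfolding pair_corr_def by (simp del: sum.op_ivl_Suc)
qed

section \<open>Levels, strata and the greedy rule\<close>

locale levels =
  fixes \<eta> :: "nat \<Rightarrow> nat"
  assumes \<eta>_0: "\<eta> 0 = 0" and \<eta>_mono: "mono \<eta>" and \<eta>_Suc: "\<eta> (Suc k) \<le> Suc (\<eta> k)"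
begin

text \<open>The subtraction never truncates, by \<open>\<eta>_le\<close>. A stratum holds
  \<open>depth k\<close> grid points (\<open>grid_eq\<close>) and is visited
  \<open>2 ^ \<eta> k\<close> times during level \<open>k\<close>
  (\<open>strata_times_power\<close>).\<close>

definition strata :: "nat \<Rightarrow> nat" where "strata k = 2 ^ (k - \<eta> k)"
definition depth :: "nat \<Rightarrow> nat" where "depth k = 4 ^ \<eta> k"
definition grid :: "nat \<Rightarrow> nat" where "grid k = 2 ^ (k + \<eta> k)"

text \<open>
  Level \<open>k\<close> consists of the indices \<open>2 ^ k \<le> n < 2 ^ Suc k\<close>. The \<open>n\<close>-th point is confined to the
  stratum with number \<open>n mod strata k\<close>; only its offset \<open>v < depth k\<close> within the stratum is free.
\<close>

definition pos :: "nat \<Rightarrow> nat \<Rightarrow> real" where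
  "pos n v = (let k = floor_log n in real ((n mod strata k) * depth k + v) / real (grid k))"

text \<open>
  Over a full run of strata these averages add up to a count over the entire grid, which depends only
  on the number of earlier points and not on their positions.
\<close>

definition mean :: "(nat \<Rightarrow> real) \<Rightarrow> nat \<Rightarrow> real \<Rightarrow> real" where
  "mean x n t = (let D = depth (floor_log n) in (\<Sum>v<D. real (near x n t (pos n v))) / D)"

definition dev :: "(nat \<Rightarrow> real) \<Rightarrow> nat \<Rightarrow> real \<Rightarrow> real" where
  "dev x n t = real (near x n t (x n)) - mean x n t"

text \<open>The thresholds reach up to the stratum length
  \<open>depth k / grid k = 1 / strata k\<close>. The sums restart at \<open>2 ^ k\<close> because
  the grid changes with the level.\<close>

definition energy :: "(nat \<Rightarrow> real) \<Rightarrow> nat \<Rightarrow> nat \<Rightarrow> real" where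
  "energy x k n = (\<Sum>m=1..depth k. (\<Sum>j=2 ^ k..<n. dev x j (real m / grid k))\<^sup>2)"

text \<open>The permitted increase is what \<open>exists_below_average_step\<close> guarantees for a
  suitable offset.\<close>

definition greedy :: "(nat \<Rightarrow> real) \<Rightarrow> bool" where
  "greedy x \<longleftrightarrow> (\<forall>n\<ge>1. let k = floor_log n; D = depth k in
     (\<exists>v<D. x n = pos n v) \<and>
     energy x k (Suc n) \<le> energy x k n +
       (\<Sum>m=1..D. (\<Sum>v<D. (real (near x n (real m / grid k) (pos n v)))\<^sup>2) / D))"

lemma near_cong: "(\<And>i. i < n \<Longrightarrow> x i = y i) \<Longrightarrow> near x n t p = near y n t p"
  unfolding near_def by (intro arg_cong[of _ _ card]) auto

lemma mean_cong: "(\<And>i. i < n \<Longrightarrow> x i = y i) \<Longrightarrow> mean x n t = mean y n t"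
  unfolding mean_def Let_def using near_cong[of n x y] by simp

lemma dev_cong: "(\<And>i. i \<le> n \<Longrightarrow> x i = y i) \<Longrightarrow> dev x n t = dev y n t"
  unfolding dev_def using near_cong[of n x y] mean_cong[of n x y] by simp

lemma energy_cong: "(\<And>i. i < n \<Longrightarrow> x i = y i) \<Longrightarrow> energy x k n = energy y k n"
  unfolding energy_def
  by (intro sum.cong refl arg_cong[where f = "\<lambda>z. z\<^sup>2"] dev_cong) auto

lemma strata_pos [simp]: "strata k > 0" and depth_pos [simp]: "depth k > 0"
  and grid_pos [simp]: "grid k > 0"
  by (simp_all add: strata_def depth_def grid_def)

lemma greedy_exists: "\<exists>x. greedy x"
proof -
  \<comment> \<open>The candidate \<open>r\<close> is kept apart from \<open>f\<close>, and the last
    deviation is split off the energy, so that \<open>P f n r\<close> depends on \<open>f\<close>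
    below \<open>n\<close> only. This makes a choice by well-founded recursion possible.\<close>
  define P where "P f n r \<longleftrightarrow> (n \<ge> 1 \<longrightarrow> (let k = floor_log n; D = depth k in
     (\<exists>v<D. r = pos n v) \<and>
     (\<Sum>m=1..D. ((\<Sum>j=2 ^ k..<n. dev f j (real m / grid k)) +
       (real (near f n (real m / grid k) r) - mean f n (real m / grid k)))\<^sup>2) \<le> energy f k n +
       (\<Sum>m=1..D. (\<Sum>v<D. (real (near f n (real m / grid k) (pos n v)))\<^sup>2) / D)))"
    for f n r
  have "\<exists>x. \<forall>n. P x n (x n)"
  proof (rule dependent_wellorder_choice)
    fix r :: real and f g :: "nat \<Rightarrow> real" and n :: nat
    assume fg: "\<And>i. i < n \<Longrightarrow> f i = g i"
    have "(\<Sum>j=2 ^ k..<n. dev f j t) = (\<Sum>j=2 ^ k..<n. dev g j t)" for k t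
      by (intro sum.cong refl dev_cong) (use fg in auto)
    then show "P f n r = P g n r"
      unfolding P_def using near_cong[of n f g, OF fg] mean_cong[of n f g, OF fg]
        energy_cong[of n f g, OF fg] by (simp add: Let_def)
  next
    fix n :: nat and f :: "nat \<Rightarrow> real"
    define k where "k = floor_log n"
    obtain v where "v < depth k"
      "(\<Sum>m=1..depth k. ((\<Sum>j=2 ^ k..<n. dev f j (real m / grid k)) +
       (real (near f n (real m / grid k) (pos n v)) - mean f n (real m / grid k)))\<^sup>2) \<le> energy f k n +
       (\<Sum>m=1..depth k. (\<Sum>v<depth k. (real (near f n (real m / grid k) (pos n v)))\<^sup>2) / depth k)"
      unfolding mean_def energy_def Let_def k_def[symmetric]
      using exists_below_average_step[where D = "depth k" and M = "{1..depth k}"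
          and S = "\<lambda>m. \<Sum>j=2 ^ k..<n. dev f j (real m / grid k)"
          and a = "\<lambda>m v. real (near f n (real m / grid k) (pos n v))"] by auto
    then have "P f n (pos n v)"
      unfolding P_def Let_def k_def[symmetric] by blast
    then show "\<exists>r. P f n r" by blast
  qed
  then obtain x where x: "\<And>n. P x n (x n)" by blast
  have "greedy x"
    unfolding greedy_def
  proof (intro allI impI)
    fix n :: nat assume n: "n \<ge> 1"
    define k where "k = floor_log n"
    have "2 ^ k \<le> n" using n by (simp add: k_def floor_log_exp2_le)
    then have "energy x k (Suc n) = (\<Sum>m=1..depth k. ((\<Sum>j=2 ^ k..<n. dev x j (real m / grid k)) +
       (real (near x n (real m / grid k) (x n)) - mean x n (real m / grid k)))\<^sup>2)"
      unfolding energy_def by (intro sum.cong refl) (simp add: dev_def)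
    then show "let k = floor_log n; D = depth k in (\<exists>v<D. x n = pos n v) \<and>
     energy x k (Suc n) \<le> energy x k n +
       (\<Sum>m=1..D. (\<Sum>v<D. (real (near x n (real m / grid k) (pos n v)))\<^sup>2) / D)"
      using x[of n] n unfolding P_def Let_def k_def[symmetric] by simp
  qed
  then show ?thesis by blast
qed

lemma \<eta>_le: "\<eta> k \<le> k"
proof (induction k)
  case (Suc k)
  then show ?case using \<eta>_Suc[of k] by linarith
qed (simp add: \<eta>_0)

lemma grid_eq: "grid k = strata k * depth k"
proof -
  have "(4::nat) ^ \<eta> k = 2 ^ (2 * \<eta> k)" by (simp add: power_mult)
  moreover have "k + \<eta> k = (k - \<eta> k) + 2 * \<eta> k" using \<eta>_le[of k] by simp
  ultimately show ?thesis
    unfolding grid_def strata_def depth_def by (metis power_add)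
qed

lemma strata_times_power: "real (strata k) * 2 ^ \<eta> k = 2 ^ k"
  by (simp add: strata_def \<eta>_le flip: power_add)

text \<open>As \<open>\<eta>\<close> grows by at most one per step, \<open>k - \<eta> k\<close>
  never decreases.\<close>

lemma strata_mono: "k \<le> l \<Longrightarrow> strata k \<le> strata l"
proof -
  assume "k \<le> l"
  moreover have "k - \<eta> k \<le> Suc k - \<eta> (Suc k)" for k using \<eta>_Suc[of k] \<eta>_le[of k] by linarith
  ultimately have "k - \<eta> k \<le> l - \<eta> l" by (rule lift_Suc_mono_le[rotated])
  then show ?thesis by (simp add: strata_def)
qed

text \<open>Later grids refine earlier ones, so at each level all points so far lie on one common
  grid.\<close>

lemma grid_dvd: "k \<le> l \<Longrightarrow> grid k dvd grid l"
  unfolding grid_def using monoD[OF \<eta>_mono, of k l] by (intro le_imp_power_dvd) simp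

lemma floor_log_level: "2 ^ k \<le> n \<Longrightarrow> n < 2 ^ Suc k \<Longrightarrow> floor_log n = k"
  by (intro floor_log_eqI) (auto intro: order_less_le_trans[of 0 "2 ^ k"])

lemma pos_stratum:
  fixes n k :: nat
  assumes "2 ^ k \<le> n" "n < 2 ^ Suc k" "v < depth k"
  shows "real (n mod strata k) / strata k \<le> pos n v"
    "pos n v < (real (n mod strata k) + 1) / strata k"
proof -
  have "pos n v = (real (n mod strata k) * depth k + v) / (real (strata k) * depth k)"
    by (simp add: pos_def Let_def floor_log_level[OF assms(1,2)] grid_eq)
  also have "\<dots> = (real (n mod strata k) + real v / depth k) / strata k"
    by (simp add: field_simps)
  finally have eq: "pos n v = \<dots>" .
  show "real (n mod strata k) / strata k \<le> pos n v"
    unfolding eq by (intro divide_right_mono) auto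
  show "pos n v < (real (n mod strata k) + 1) / strata k"
    unfolding eq using assms(3) by (intro divide_strict_right_mono) auto
qed

lemma pos_grid: "2 ^ k \<le> n \<Longrightarrow> n < 2 ^ Suc k \<Longrightarrow> pos n v * real (grid k) \<in> \<int>"
  by (simp add: pos_def floor_log_level)

end

section \<open>Local density and energy of a greedy sequence\<close>

locale greedy_sequence = levels +
  fixes x :: "nat \<Rightarrow> real"
  assumes greedy: "greedy x"
begin

lemma level_exists:
  assumes "n \<ge> 1"
  obtains k where "2 ^ k \<le> n" "n < 2 ^ Suc k" "floor_log n = k"
  using assms floor_log_exp2_le[of n] floor_log_exp2_gt[of n] by auto

lemma x_eq_pos:
  assumes "2 ^ k \<le> n" "n < 2 ^ Suc k"
  obtains v where "v < depth k" "x n = pos n v"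
proof -
  have "n \<ge> 1" using assms(1) by (metis le_trans one_le_numeral one_le_power)
  then show ?thesis
    using greedy that floor_log_level[OF assms] unfolding greedy_def Let_def by blast
qed

lemma x_stratum:
  assumes "2 ^ k \<le> n" "n < 2 ^ Suc k"
  shows "real (n mod strata k) / strata k \<le> x n" "x n < (real (n mod strata k) + 1) / strata k"
  using x_eq_pos[OF assms] pos_stratum[OF assms] by metis+

lemma x_range: "n \<ge> 1 \<Longrightarrow> x n \<in> {0..<1}"
proof -
  assume "n \<ge> 1"
  then obtain k where k: "2 ^ k \<le> n" "n < 2 ^ Suc k" using level_exists by blast
  have "n mod strata k < strata k" by simp
  then have "real (n mod strata k) + 1 \<le> strata k" by linarith
  then have "(real (n mod strata k) + 1) / strata k \<le> 1" by simp
  moreover have "0 \<le> real (n mod strata k) / strata k" by simp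
  ultimately show ?thesis
    using x_stratum[OF k] unfolding atLeastLessThan_iff by linarith
qed

lemma x_grid:
  assumes "n \<ge> 1" "n < 2 ^ Suc k"
  shows "x n * real (grid k) \<in> \<int>"
proof -
  obtain l where l: "2 ^ l \<le> n" "n < 2 ^ Suc l" using level_exists assms(1) by blast
  then have "(2::nat) ^ l < 2 ^ Suc k" using assms(2) by linarith
  then have "l \<le> k" using power_less_imp_less_exp[of "2::nat" l "Suc k"] by simp
  then obtain d where d: "grid k = grid l * d" using grid_dvd by blast
  obtain v where "x n = pos n v" using x_eq_pos[OF l] by blast
  then have "x n * real (grid l) \<in> \<int>" using pos_grid[OF l] by simp
  then have "x n * real (grid l) * real d \<in> \<int>" by (rule Ints_mult) simp
  then show ?thesis by (simp only: d of_nat_mult mult.assoc)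
qed

text \<open>A point within \<open>1 / strata k\<close> of \<open>p\<close> has the left end of its
  stratum within \<open>2 / strata k\<close> of \<open>p\<close>. At most 5 strata qualify, and a
  level makes \<open>2 ^ \<eta> k\<close> rounds through the strata.\<close>

lemma card_level_near:
  "real (card {i\<in>{2 ^ k..<2 ^ Suc k}. torus_abs (x i - p) < 1 / strata k}) \<le> 10 * 2 ^ \<eta> k"
proof -
  let ?S = "strata k"
  define F :: "nat \<Rightarrow> real" where
    "F i = of_bool (torus_abs (p - real (i mod ?S) / ?S) < 2 / ?S)" for i
  have sub: "torus_abs (p - real (i mod ?S) / ?S) < 2 / ?S"
    if i: "i \<in> {2 ^ k..<2 ^ Suc k}" "torus_abs (x i - p) < 1 / ?S" for i
  proof -
    obtain m :: int where m: "\<bar>x i - p - m\<bar> < 1 / ?S" using i(2) torus_abs_less_iff by blast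
    have "real (i mod ?S) / ?S \<le> x i" "x i < real (i mod ?S) / ?S + 1 / ?S"
      using x_stratum[of k i] i(1) by (simp_all add: add_divide_distrib)
    then have "\<bar>p - real (i mod ?S) / ?S - of_int (- m)\<bar> < 1 / ?S + 1 / ?S"
      using m by simp
    then show ?thesis unfolding torus_abs_less_iff by (metis add_divide_distrib one_add_one)
  qed
  have "real (card {i\<in>{2 ^ k..<2 ^ Suc k}. torus_abs (x i - p) < 1 / ?S}) =
      (\<Sum>i=2 ^ k..<2 ^ k + 2 ^ k. of_bool (torus_abs (x i - p) < 1 / ?S))"
    by (simp add: sum.If_cases of_bool_def Int_def mult_2)
  also have "\<dots> \<le> sum F {2 ^ k..<2 ^ k + 2 ^ k}"
    by (intro sum_mono) (use sub in \<open>auto simp: F_def\<close>)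
  also have "\<dots> \<le> real (2 ^ k) * (sum F {..<?S} / ?S) + sum F {..<?S}"
    using sum_periodic[of F ?S "2 ^ k" "2 ^ k"] by (simp add: F_def abs_le_iff)
  also have "\<dots> = (2 ^ \<eta> k + 1) * sum F {..<?S}"
    using strata_times_power[of k] by (simp add: field_simps)
  also have "sum F {..<?S} = real (card {w\<in>{..<?S}. torus_abs (p - real w / ?S) < 2 / ?S})"
    by (simp add: F_def of_bool_def sum.If_cases Int_def cong: conj_cong)
  also have "(2 ^ \<eta> k + 1) * \<dots> \<le> (2 ^ \<eta> k + 1) * 5"
    using card_grid_near_le[of ?S "2 / ?S" p] by (intro mult_left_mono) auto
  also have "\<dots> \<le> 10 * 2 ^ \<eta> k" by simp
  finally show ?thesis .
qed

text \<open>Strata never lengthen as the level rises, so \<open>t\<close> is at most the stratum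
  length at each of the \<open>k + 1\<close> levels up to \<open>k\<close>, and
  \<open>card_level_near\<close> applies to all of them.\<close>

lemma near_le:
  assumes n: "n \<le> 2 ^ Suc k" and t: "t \<le> 1 / strata k"
  shows "real (near x n t p) \<le> 10 * (real k + 1) * 2 ^ \<eta> k"
proof -
  let ?A = "\<lambda>l. {i\<in>{2 ^ l..<2 ^ Suc l}. torus_abs (x i - p) < 1 / strata l}"
  have "{i\<in>{1..<n}. torus_abs (x i - p) < t} \<subseteq> (\<Union>l\<le>k. ?A l)"
  proof
    fix i assume i: "i \<in> {i\<in>{1..<n}. torus_abs (x i - p) < t}"
    then obtain l where l: "2 ^ l \<le> i" "i < 2 ^ Suc l" using level_exists[of i] by auto
    have "(2::nat) ^ l < 2 ^ Suc k" using l i n by auto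
    then have "l \<le> k" using power_less_imp_less_exp[of "2::nat" l "Suc k"] by simp
    then have "1 / real (strata k) \<le> 1 / strata l"
      using strata_mono by (intro divide_left_mono) auto
    then have "i \<in> ?A l" using i l t by auto
    then show "i \<in> (\<Union>l\<le>k. ?A l)" using \<open>l \<le> k\<close> by blast
  qed
  then have "near x n t p \<le> card (\<Union>l\<le>k. ?A l)"
    unfolding near_def by (intro card_mono) auto
  also have "\<dots> \<le> (\<Sum>l\<le>k. card (?A l))" by (intro card_UN_le) auto
  finally have "real (near x n t p) \<le> (\<Sum>l\<le>k. real (card (?A l)))"
    by (simp only: of_nat_le_iff flip: of_nat_sum)
  also have "\<dots> \<le> (\<Sum>l\<le>k. 10 * 2 ^ \<eta> k)"
  proof (intro sum_mono)
    fix l assume "l \<in> {..k}"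
    then have "(2::real) ^ \<eta> l \<le> 2 ^ \<eta> k"
      using monoD[OF \<eta>_mono] by (intro power_increasing) auto
    then show "real (card (?A l)) \<le> 10 * 2 ^ \<eta> k" using card_level_near[of l p] by linarith
  qed
  finally show ?thesis by (simp add: algebra_simps)
qed

text \<open>
  Each index contributes only the mean square of \<open>near\<close>, so the energy of a level grows linearly in
  its length (up to subexponential factors): there is square-root cancellation.
\<close>

lemma energy_le:
  assumes "2 ^ k \<le> n" "n \<le> 2 ^ Suc k"
  shows "energy x k n \<le> (real n - 2 ^ k) * depth k * (10 * (real k + 1) * 2 ^ \<eta> k)\<^sup>2"
  using assms
proof (induction n rule: dec_induct)
  case base
  then show ?case by (simp add: energy_def)
next
  case (step n)
  let ?B = "10 * (real k + 1) * 2 ^ \<eta> k" and ?D = "depth k"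
  have lv: "2 ^ k \<le> n" "n < 2 ^ Suc k" "n \<ge> 1"
    using step.hyps step.prems one_le_power[of "2::nat" k] by linarith+
  have "(\<Sum>v<?D. (real (near x n (real m / grid k) (pos n v)))\<^sup>2) / ?D \<le> ?B\<^sup>2"
    if "m \<in> {1..?D}" for m
  proof -
    have "real m / grid k \<le> real ?D / grid k" using that by (intro divide_right_mono) auto
    also have "\<dots> = 1 / strata k" by (simp add: grid_eq)
    finally have "(real (near x n (real m / grid k) p))\<^sup>2 \<le> ?B\<^sup>2" for p
      using near_le[of n k "real m / grid k"] lv by (intro power_mono) auto
    then have "(\<Sum>v<?D. (real (near x n (real m / grid k) (pos n v)))\<^sup>2) \<le> (\<Sum>v<?D. ?B\<^sup>2)"
      by (intro sum_mono)
    then show ?thesis by (simp add: field_simps)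
  qed
  then have "(\<Sum>m=1..?D. (\<Sum>v<?D. (real (near x n (real m / grid k) (pos n v)))\<^sup>2) / ?D)
      \<le> (\<Sum>m=1..?D. ?B\<^sup>2)"
    by (intro sum_mono)
  moreover have "energy x k (Suc n) \<le> energy x k n +
       (\<Sum>m=1..?D. (\<Sum>v<?D. (real (near x n (real m / grid k) (pos n v)))\<^sup>2) / ?D)"
    using greedy lv(3) floor_log_level[OF lv(1,2)] unfolding greedy_def Let_def by blast
  ultimately have "energy x k (Suc n) \<le> energy x k n + ?D * ?B\<^sup>2" by simp
  moreover have "energy x k n \<le> (real n - 2 ^ k) * ?D * ?B\<^sup>2"
    using step.IH lv by simp
  ultimately show ?case by (simp add: algebra_simps)
qed

text \<open>The square is one summand of the energy. Of the three factors 4 in 64, one is for the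
  \<open>depth k\<close> thresholds, one for the square of \<open>2 ^ \<eta> k\<close> in
  \<open>near_le\<close>, and one brings \<open>2 ^ k * 2 ^ k\<close> down to the square of
  \<open>strata k\<close>.\<close>

lemma sum_dev_le:
  assumes n: "2 ^ k \<le> n" "n \<le> 2 ^ Suc k" and m: "m \<in> {1..depth k}"
    and k: "100 * (real k + 1)\<^sup>2 * 64 ^ \<eta> k \<le> 2 ^ k"
  shows "\<bar>\<Sum>j=2 ^ k..<n. dev x j (real m / grid k)\<bar> \<le> strata k"
proof -
  have "(\<Sum>j=2 ^ k..<n. dev x j (real m / grid k))\<^sup>2 \<le> energy x k n"
    unfolding energy_def
    by (rule member_le_sum[OF m, where f = "\<lambda>m. (\<Sum>j=2 ^ k..<n. dev x j (real m / grid k))\<^sup>2"]) auto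
  also have "\<dots> \<le> (real n - 2 ^ k) * depth k * (10 * (real k + 1) * 2 ^ \<eta> k)\<^sup>2"
    by (rule energy_le[OF n])
  also have "\<dots> \<le> 2 ^ k * depth k * (10 * (real k + 1) * 2 ^ \<eta> k)\<^sup>2"
    using n(2) of_nat_mono[OF n(2), where 'a = real] by (intro mult_right_mono) auto
  also have "\<dots> = 2 ^ k * (100 * (real k + 1)\<^sup>2 * 64 ^ \<eta> k) / 4 ^ \<eta> k"
  proof -
    have "(2::real) ^ \<eta> k * 2 ^ \<eta> k = 4 ^ \<eta> k" "(64::real) ^ \<eta> k = 4 ^ \<eta> k * 4 ^ \<eta> k * 4 ^ \<eta> k"
      by (simp_all flip: power_mult_distrib)
    then show ?thesis by (simp add: depth_def power2_eq_square field_simps)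
  qed
  also have "\<dots> \<le> 2 ^ k * 2 ^ k / 4 ^ \<eta> k"
    using k by (intro divide_right_mono mult_left_mono) auto
  also have "\<dots> = (real (strata k))\<^sup>2"
  proof -
    have "(2::real) ^ \<eta> k * 2 ^ \<eta> k = 4 ^ \<eta> k" by (simp flip: power_mult_distrib)
    moreover have "(2::real) ^ k * 2 ^ k =
        (real (strata k) * 2 ^ \<eta> k) * (real (strata k) * 2 ^ \<eta> k)"
      by (simp only: strata_times_power)
    ultimately have "(2::real) ^ k * 2 ^ k = (real (strata k))\<^sup>2 * 4 ^ \<eta> k"
      by (simp add: power2_eq_square mult_ac)
    then show ?thesis by simp
  qed
  finally show ?thesis by (simp add: abs_le_square_iff[symmetric])
qed

section \<open>Pair correlations\<close>

text \<open>For a fixed earlier point, the chance that a uniform offset lands within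
  \<open>t\<close> of it depends on \<open>n\<close> only through the stratum. A full round of
  strata runs over every grid point once and is nearly exact; the main loss is one incomplete round
  per earlier point.\<close>

lemma sum_mean_near:
  assumes M: "2 ^ k \<le> M" "M \<le> 2 ^ Suc k" and t: "0 < t" "t \<le> s / 2 ^ k" "t \<le> 1/2"
  shows "\<bar>\<Sum>n=2 ^ k..<M. mean x n t - 2 * t * real (n - 1)\<bar> \<le> (4 * s + 4) * strata k"
proof -
  let ?S = "strata k" and ?D = "depth k" and ?G = "grid k"
  define F :: "nat \<Rightarrow> nat \<Rightarrow> real" where
    "F i n = (\<Sum>v<?D. of_bool (torus_abs (x i - real ((n mod ?S) * ?D + v) / ?G) < t)) / ?D" for i n
  have G: "real ?G = real ?S * real ?D" by (simp add: grid_eq)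
  have mean: "mean x n t = (\<Sum>i=1..<n. F i n)" if "n \<in> {2 ^ k..<M}" for n
  proof -
    have [simp]: "floor_log n = k" using that M by (intro floor_log_level) auto
    have "mean x n t = (\<Sum>v<?D. \<Sum>i=1..<n. of_bool (torus_abs (x i - pos n v) < t)) / ?D"
      by (simp add: mean_def Let_def near_eq_sum)
    also have "\<dots> = (\<Sum>i=1..<n. F i n)"
      by (subst sum.swap) (simp add: F_def pos_def Let_def sum_divide_distrib)
    finally show ?thesis .
  qed
  have period: "\<bar>sum (F i) {..<?S} * ?D - 2 * t * ?G\<bar> \<le> 1" for i
  proof -
    let ?h = "\<lambda>w. of_bool (torus_abs (x i - real w / ?G) < t) :: real"
    have shift: "(\<Sum>v<?D. ?h (c * ?D + v)) = sum ?h {c * ?D..<c * ?D + ?D}" for c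
      by (rule sum.reindex_bij_witness[of _ "\<lambda>w. w - c * ?D" "\<lambda>v. c * ?D + v"]) auto
    have "sum (F i) {..<?S} * ?D = (\<Sum>c<?S. \<Sum>v<?D. ?h (c * ?D + v))"
      by (simp add: F_def flip: sum_divide_distrib)
    also have "\<dots> = (\<Sum>c<?S. sum ?h {c * ?D..<c * ?D + ?D})"
      by (simp only: shift)
    also have "\<dots> = sum ?h {..<?G}" unfolding grid_eq by (rule sum.nat_group)
    also have "\<dots> = real (card {w\<in>{..<?G}. torus_abs (x i - real w / ?G) < t})"
      by (simp add: of_bool_def sum.If_cases Int_def)
    finally show ?thesis using card_grid_near[of ?G t "x i"] t by simp
  qed
  \<comment> \<open>An incomplete round costs at most \<open>P\<close>, which is
    \<open>2 * t * ?S\<close> up to \<open>1 / ?D\<close>. The counting errors of at most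
    \<open>2 ^ \<eta> k\<close> rounds, each \<open>1 / ?D = 1 / 4 ^ \<eta> k\<close>, add
    \<open>1 / 2 ^ \<eta> k\<close>.\<close>
  have each: "\<bar>\<Sum>n=a..<M. F i n - 2 * t\<bar> \<le> 2 * t * ?S + 2 / 2 ^ \<eta> k"
    if a: "2 ^ k \<le> a" "a \<le> M" for a i
  proof -
    define P where "P = sum (F i) {..<?S}"
    define l where "l = M - a"
    have l: "M = a + l" using a by (simp add: l_def)
    have l2: "real l \<le> 2 ^ k"
    proof -
      have "l \<le> 2 ^ k" using a M by (simp add: l_def)
      then show ?thesis by (metis of_nat_le_iff of_nat_numeral of_nat_power)
    qed
    have *: "\<bar>sum (F i) {a..<M} - real l * (P / ?S)\<bar> \<le> P"
      unfolding P_def l by (rule sum_periodic) (auto simp: F_def intro!: divide_nonneg_nonneg sum_nonneg)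
    have Pt: "\<bar>P - 2 * t * ?S\<bar> \<le> 1 / ?D"
    proof -
      have "\<bar>P - 2 * t * ?S\<bar> * ?D = \<bar>(P - 2 * t * ?S) * ?D\<bar>" by (simp add: abs_mult)
      also have "\<dots> \<le> 1" using period[of i] by (simp add: P_def G algebra_simps)
      finally show ?thesis by (simp add: pos_le_divide_eq)
    qed
    have D: "1 / real ?D \<le> 1 / 2 ^ \<eta> k"
      by (intro divide_left_mono) (auto simp: depth_def intro: power_mono)
    have "\<bar>real l * (P / ?S) - 2 * t * l\<bar> = real l / ?S * \<bar>P - 2 * t * ?S\<bar>"
    proof -
      have "real l * (P / ?S) - 2 * t * l = real l / ?S * (P - 2 * t * ?S)"
        by (simp add: field_simps)
      then show ?thesis by (simp add: abs_mult)
    qed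
    also have "\<dots> \<le> 2 ^ k / ?S * (1 / ?D)"
      using l2 Pt by (intro mult_mono divide_right_mono) auto
    also have "\<dots> = 2 ^ \<eta> k * (1 / ?D)"
      using strata_times_power[of k] by (simp add: field_simps)
    also have "\<dots> = 1 / 2 ^ \<eta> k"
    proof -
      have "(2::real) ^ \<eta> k * 2 ^ \<eta> k = 4 ^ \<eta> k" by (simp flip: power_mult_distrib)
      then show ?thesis by (simp add: depth_def field_simps)
    qed
    finally have lP: "\<bar>real l * (P / ?S) - 2 * t * l\<bar> \<le> 1 / 2 ^ \<eta> k" .
    have "\<bar>z - w\<bar> \<le> q + 2 * e"
      if "\<bar>z - y\<bar> \<le> P" "\<bar>y - w\<bar> \<le> e" "\<bar>P - q\<bar> \<le> d" "d \<le> e" for d e q w y z :: real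
      using that by linarith
    from this[OF * lP Pt D] show ?thesis by (simp add: sum_subtractf l mult.commute)
  qed
  have "(\<Sum>n=2 ^ k..<M. mean x n t - 2 * t * real (n - 1)) =
      (\<Sum>n=2 ^ k..<M. \<Sum>i=1..<n. F i n - 2 * t)"
    by (intro sum.cong refl) (simp add: mean sum_subtractf)
  also have "\<dots> = (\<Sum>i=1..<M. \<Sum>n=max (2 ^ k) (Suc i)..<M. F i n - 2 * t)"
    by (rule sum_triangle_swap)
  also have "\<bar>\<dots>\<bar> \<le> (\<Sum>i=1..<M. 2 * t * ?S + 2 / 2 ^ \<eta> k)"
    by (intro order_trans[OF sum_abs] sum_mono each) (use M in auto)
  also have "\<dots> = real (M - 1) * (2 * t * ?S + 2 / 2 ^ \<eta> k)" by simp
  also have "\<dots> \<le> (2 * 2 ^ k) * (2 * (s / 2 ^ k) * ?S + 2 / 2 ^ \<eta> k)"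
  proof -
    have "M - 1 \<le> 2 * 2 ^ k" using M by simp
    then have "real (M - 1) \<le> 2 * 2 ^ k"
      by (metis of_nat_le_iff of_nat_mult of_nat_numeral of_nat_power)
    then show ?thesis
      using t by (intro mult_mono add_mono mult_right_mono add_nonneg_nonneg) auto
  qed
  also have "\<dots> = (4 * s + 4) * ?S"
  proof -
    have S: "real ?S = 2 ^ k / 2 ^ \<eta> k"
      using strata_times_power[of k] by (simp add: field_simps)
    show ?thesis unfolding S by (simp add: field_simps)
  qed
  finally show ?thesis .
qed

text \<open>The subtracted term is the expected number of hits of \<open>n - 1\<close> uniform
  random points in an arc of length \<open>2 * t\<close>.\<close>

definition discrepancy :: "real \<Rightarrow> nat \<Rightarrow> real" where
  "discrepancy t n = real (near x n t (x n)) - 2 * t * real (n - 1)"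

text \<open>The deviation from the mean costs \<open>strata k\<close>, the error of the mean itself
  \<open>(4 * s + 4) * strata k\<close>. The former is controlled only at multiples of the mesh, so
  \<open>t\<close> is rounded up first.\<close>

lemma sum_discrepancy_level:
  assumes M: "2 ^ k \<le> M" "M \<le> 2 ^ Suc k" and t: "0 < t" "t \<le> s / 2 ^ k"
    and k: "100 * (real k + 1)\<^sup>2 * 64 ^ \<eta> k \<le> 2 ^ k" and s: "s \<le> 2 ^ \<eta> k" "2 * s \<le> 2 ^ k"
  shows "\<bar>sum (discrepancy t) {2 ^ k..<M}\<bar> \<le> (4 * s + 5) * strata k"
proof -
  let ?G = "grid k"
  define m where "m = nat \<lceil>t * ?G\<rceil>"
  have tG: "0 < t * ?G" using t by simp
  then have m_eq: "of_int \<lceil>t * ?G\<rceil> = real m" by (simp add: m_def)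
  have "t * ?G \<le> s / 2 ^ k * ?G" using t by (intro mult_right_mono) auto
  also have "\<dots> = s * 2 ^ \<eta> k" by (simp add: grid_def power_add)
  also have "\<dots> \<le> 2 ^ \<eta> k * 2 ^ \<eta> k" using s by (intro mult_right_mono) auto
  also have "\<dots> = depth k" by (simp add: depth_def flip: power_mult_distrib)
  \<comment> \<open>\<open>s \<le> 2 ^ \<eta> k\<close> keeps the rounded threshold within the range
    covered by the energy.\<close>
  finally have "\<lceil>t * ?G\<rceil> \<le> int (depth k)" by (simp add: ceiling_le_iff)
  then have m: "m \<in> {1..depth k}" using tG by (simp add: m_def nat_le_iff) linarith
  have t2: "t \<le> 1/2"
  proof -
    have "s / 2 ^ k \<le> 1/2" using s(2) by (simp add: pos_divide_le_eq)
    then show ?thesis using t by linarith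
  qed
  have near: "near x n t p = near x n (real m / ?G) p"
    if "n \<in> {2 ^ k..<M}" "p * real ?G \<in> \<int>" for n p
  proof -
    have "torus_abs (x i - p) < t \<longleftrightarrow> torus_abs (x i - p) < real m / ?G" if i: "i \<in> {1..<n}" for i
    proof -
      have "x i * real ?G \<in> \<int>" using i that M \<open>n \<in> {2 ^ k..<M}\<close> by (intro x_grid) auto
      then have "(x i - p) * real ?G \<in> \<int>"
        using \<open>p * real ?G \<in> \<int>\<close> by (simp add: left_diff_distrib)
      from torus_abs_less_grid_iff[OF this, of t] show ?thesis by (simp add: m_eq)
    qed
    then show ?thesis unfolding near_def by (intro arg_cong[of _ _ card]) auto
  qed
  have dev: "dev x n t = dev x n (real m / ?G)" if n: "n \<in> {2 ^ k..<M}" for n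
  proof -
    have lv: "2 ^ k \<le> n" "n < 2 ^ Suc k" using n M by auto
    have "x n * real ?G \<in> \<int>" using lv one_le_power[of "2::nat" k] by (intro x_grid) linarith+
    moreover have "pos n v * real ?G \<in> \<int>" for v by (rule pos_grid[OF lv])
    ultimately show ?thesis
      unfolding dev_def mean_def Let_def using near[OF n] by simp
  qed
  have "sum (discrepancy t) {2 ^ k..<M} =
      (\<Sum>n=2 ^ k..<M. dev x n t) + (\<Sum>n=2 ^ k..<M. mean x n t - 2 * t * real (n - 1))"
    by (simp add: discrepancy_def dev_def flip: sum.distrib)
  also have "(\<Sum>n=2 ^ k..<M. dev x n t) = (\<Sum>n=2 ^ k..<M. dev x n (real m / ?G))"
    by (intro sum.cong dev) auto
  finally show ?thesis
    using sum_dev_le[OF M m k] sum_mean_near[OF M t t2] by (simp add: algebra_simps)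
qed

text \<open>Since \<open>s / 2 ^ k\<close> decreases in \<open>k\<close>, a threshold suited to
  level \<open>K\<close> suits all lower levels, and the bounds of the levels add up.\<close>

lemma sum_discrepancy_levels:
  assumes "k0 \<le> K"
    and k: "\<And>k. k \<ge> k0 \<Longrightarrow> 100 * (real k + 1)\<^sup>2 * 64 ^ \<eta> k \<le> 2 ^ k \<and> s \<le> 2 ^ \<eta> k \<and> 2 * s \<le> 2 ^ k"
    and t: "0 < t" "t \<le> s / 2 ^ K" and M: "2 ^ k0 \<le> M" "M \<le> 2 ^ Suc K"
  shows "\<bar>sum (discrepancy t) {2 ^ k0..<M}\<bar> \<le> (4 * s + 5) * (\<Sum>k=k0..K. strata k)"
  using assms(1) t M
proof (induction K arbitrary: M rule: dec_induct)
  case base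
  then show ?case using sum_discrepancy_level[of k0 M t s] k by simp
next
  case (step K)
  have s: "0 < s" using step.prems by (metis less_le_trans zero_less_divide_iff zero_less_numeral zero_less_power not_less_iff_gr_or_eq)
  have t': "t \<le> s / 2 ^ K"
  proof -
    have "s / 2 ^ Suc K \<le> s / 2 ^ K" using s by (intro divide_left_mono power_increasing) auto
    then show ?thesis using step.prems by linarith
  qed
  show ?case
  proof (cases "M \<le> 2 ^ Suc K")
    case True
    have "(4 * s + 5) * real (\<Sum>k=k0..K. strata k) \<le> (4 * s + 5) * real (\<Sum>k=k0..Suc K. strata k)"
      using s by (intro mult_left_mono of_nat_mono sum_mono2) auto
    then show ?thesis using step.IH[OF step.prems(1) t' step.prems(3) True] by linarith
  next
    case False
    have k0: "(2::nat) ^ k0 \<le> 2 ^ Suc K" using step.hyps by (intro power_increasing) auto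
    then have "sum (discrepancy t) {2 ^ k0..<M} =
        sum (discrepancy t) {2 ^ k0..<2 ^ Suc K} + sum (discrepancy t) {2 ^ Suc K..<M}"
      using False by (intro sum.atLeastLessThan_concat[symmetric]) auto
    moreover have "\<bar>sum (discrepancy t) {2 ^ k0..<2 ^ Suc K}\<bar> \<le> (4 * s + 5) * (\<Sum>k=k0..K. strata k)"
      using step.IH[OF step.prems(1) t' k0] by simp
    moreover have "\<bar>sum (discrepancy t) {2 ^ Suc K..<M}\<bar> \<le> (4 * s + 5) * strata (Suc K)"
      using k[of "Suc K"] step.hyps step.prems False by (intro sum_discrepancy_level) auto
    moreover have "(\<Sum>k=k0..Suc K. strata k) = (\<Sum>k=k0..K. strata k) + strata (Suc K)"
      using step.hyps by simp
    ultimately show ?thesis by (simp add: distrib_left)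
  qed
qed

text \<open>The accumulated error is a multiple of the sum of
  \<open>strata k = 2 ^ k / 2 ^ \<eta> k\<close> over the levels reached, which is negligible
  against \<open>N\<close>.\<close>

lemma poissonian:
  assumes \<eta>_lim: "filterlim \<eta> at_top sequentially"
    and growth: "\<forall>\<^sub>F k in sequentially. 100 * (real k + 1)\<^sup>2 * 64 ^ \<eta> k \<le> 2 ^ k"
  shows "poissonian_pair_correlations x"
  unfolding poissonian_pair_correlations_def
proof (intro allI impI)
  fix s :: real assume s: "s > 0"
  have "filterlim (\<lambda>k. (2::real) ^ \<eta> k) at_top sequentially"
    by (rule filterlim_compose[OF _ \<eta>_lim]) real_asymp
  then have "\<forall>\<^sub>F k in sequentially. s \<le> 2 ^ \<eta> k" by (auto simp: filterlim_at_top)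
  moreover have "\<forall>\<^sub>F k in sequentially. 2 * s \<le> 2 ^ k" by real_asymp
  ultimately have "\<forall>\<^sub>F k in sequentially.
      100 * (real k + 1)\<^sup>2 * 64 ^ \<eta> k \<le> 2 ^ k \<and> s \<le> 2 ^ \<eta> k \<and> 2 * s \<le> 2 ^ k"
    using growth by eventually_elim auto
  then obtain k0 where k0: "\<And>k. k \<ge> k0 \<Longrightarrow>
      100 * (real k + 1)\<^sup>2 * 64 ^ \<eta> k \<le> 2 ^ k \<and> s \<le> 2 ^ \<eta> k \<and> 2 * s \<le> 2 ^ k"
    by (auto simp: eventually_sequentially)
  define H where "H K = real (\<Sum>k\<le>K. strata k) / 2 ^ K" for K
  define A where "A = (\<Sum>n=1..<2 ^ k0. real n + 2 * s)"
  \<comment> \<open>In this order: the main term is \<open>2 * s * (N - 1) / N\<close> rather than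
    \<open>2 * s\<close>; the initial indices; the levels from \<open>k0\<close> on. The last two
    are doubled because ordered pairs are counted.\<close>
  let ?E = "\<lambda>N. 2 * s / real N + 2 * A / real N + (8 * s + 10) * H (floor_log N)"
  have "(\<lambda>k. real (strata k) / 2 ^ k) \<longlonglongrightarrow> 0"
  proof -
    have "real (strata k) / 2 ^ k = 1 / 2 ^ \<eta> k" for k
      using strata_times_power[of k] by (simp add: field_simps)
    moreover have "(\<lambda>k. 1 / (2::real) ^ \<eta> k) \<longlonglongrightarrow> 0"
      by (rule filterlim_compose[OF _ \<eta>_lim]) real_asymp
    ultimately show ?thesis by simp
  qed
  then have "H \<longlonglongrightarrow> 0" unfolding H_def by (rule sum_over_power2_tendsto_0)
  then have H: "(\<lambda>N. H (floor_log N)) \<longlonglongrightarrow> 0"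
    by (rule filterlim_compose[OF _ filterlim_floor_log])
  have E: "?E \<longlonglongrightarrow> 0"
  proof -
    have "(\<lambda>N. 2 * s / real N + 2 * A / real N) \<longlonglongrightarrow> 0" by real_asymp
    from tendsto_add[OF this tendsto_mult_left[OF H, of "8 * s + 10"]] show ?thesis by simp
  qed
  have bound: "norm (pair_corr x N s - 2 * s) \<le> ?E N" if N: "N \<ge> 2 ^ k0" for N
  proof -
    define K where "K = floor_log N"
    define t where "t = s / N"
    have N1: "N \<ge> 1" using N one_le_power[of "2::nat" k0] by linarith
    have NK: "2 ^ K \<le> N" "N < 2 ^ Suc K"
      using N1 floor_log_exp2_le[of N] floor_log_exp2_gt[of N] by (auto simp: K_def)
    have "(2::nat) ^ k0 < 2 ^ Suc K" using N NK by linarith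
    then have k0K: "k0 \<le> K" using power_less_imp_less_exp[of "2::nat" k0 "Suc K"] by simp
    have NK': "2 ^ K \<le> real N" using NK(1) by (metis of_nat_le_iff of_nat_numeral of_nat_power)
    have t: "0 < t" "t \<le> s / 2 ^ K" "t \<le> s"
      using s N1 NK' by (auto simp: t_def intro!: divide_left_mono) (simp add: field_simps)
    have "\<bar>sum (discrepancy t) {1..<2 ^ k0}\<bar> \<le> A"
      unfolding A_def
    proof (intro order_trans[OF sum_abs] sum_mono)
      fix n :: nat assume n: "n \<in> {1..<2 ^ k0}"
      have "near x n t (x n) \<le> card {1..<n}" unfolding near_def by (intro card_mono) auto
      then have "real (near x n t (x n)) \<le> n" by simp
      moreover have "2 * t * real (n - 1) \<le> 2 * t * N" using n N t by (intro mult_left_mono) auto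
      moreover have "2 * t * N = 2 * s" using N1 by (simp add: t_def)
      moreover have "0 \<le> 2 * t * real (n - 1)" using t by simp
      ultimately show "\<bar>discrepancy t n\<bar> \<le> real n + 2 * s"
        using s unfolding discrepancy_def by linarith
    qed
    moreover have "\<bar>sum (discrepancy t) {2 ^ k0..<Suc N}\<bar> \<le> (4 * s + 5) * (2 ^ K * H K)"
    proof -
      have "\<bar>sum (discrepancy t) {2 ^ k0..<Suc N}\<bar> \<le> (4 * s + 5) * real (\<Sum>k=k0..K. strata k)"
        using N NK by (intro sum_discrepancy_levels[OF k0K k0 t(1,2)]) auto
      also have "\<dots> \<le> (4 * s + 5) * real (\<Sum>k\<le>K. strata k)"
        using s by (intro mult_left_mono of_nat_mono sum_mono2) auto
      finally show ?thesis by (simp add: H_def)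
    qed
    moreover have "sum (discrepancy t) {1..<Suc N} =
        sum (discrepancy t) {1..<2 ^ k0} + sum (discrepancy t) {2 ^ k0..<Suc N}"
      using N by (intro sum.atLeastLessThan_concat[symmetric]) auto
    moreover have "(4 * s + 5) * (2 ^ K * H K) \<le> (4 * s + 5) * (N * H K)"
      using NK' s by (intro mult_left_mono mult_right_mono) (auto simp: H_def intro!: divide_nonneg_nonneg sum_nonneg)
    ultimately have D: "\<bar>sum (discrepancy t) {1..<Suc N}\<bar> \<le> A + (4 * s + 5) * (N * H K)"
      by linarith
    have "(\<Sum>n=1..<Suc N. 2 * t * real (n - 1)) = 2 * t * (real N * (real N - 1) / 2)"
    proof (induction N)
      case (Suc N)
      then show ?case by (simp add: field_simps)
    qed simp
    also have "\<dots> = s * (real N - 1)" using N1 by (simp add: t_def)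
    finally have "(\<Sum>n=1..<Suc N. real (near x n t (x n))) =
        sum (discrepancy t) {1..<Suc N} + s * (real N - 1)"
      unfolding discrepancy_def sum_subtractf by linarith
    then have "pair_corr x N s - 2 * s = (2 * sum (discrepancy t) {1..<Suc N} - 2 * s) / N"
      using N1 by (simp add: pair_corr_eq flip: t_def) (simp add: field_simps)
    also have "\<bar>\<dots>\<bar> \<le> (2 * (A + (4 * s + 5) * (N * H K)) + 2 * s) / N"
      unfolding abs_divide using D s N1 by (intro frac_le) (auto simp del: sum.op_ivl_Suc)
    also have "\<dots> = ?E N" using N1 by (simp add: field_simps flip: K_def)
    finally show ?thesis by simp
  qed
  have "(\<lambda>N. pair_corr x N s - 2 * s) \<longlonglongrightarrow> 0"
    by (rule tendsto_rabs_zero_cancel, rule tendsto_sandwich[OF _ _ tendsto_const E])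
      (use bound in \<open>auto simp: eventually_sequentially\<close>)
  then show "(\<lambda>N. pair_corr x N s) \<longlonglongrightarrow> 2 * s" by (simp add: LIM_zero_iff)
qed

section \<open>Gap lengths of the greedy sequence\<close>

lemma num_gap_lengths_x_le:
  assumes n: "2 ^ Suc k \<le> n" "n < 2 ^ Suc (Suc k)"
  shows "num_gap_lengths x n \<le> 4 ^ (\<eta> (Suc k) + 1)"
\<comment> \<open>The grid is that of the current level \<open>Suc k\<close>, which may be
  incomplete; the strata are those of level \<open>k\<close>, whose points are all present.\<close>
proof (rule num_gap_lengths_le[where g = "grid (Suc k)" and S = "strata k"])
  show "x i \<in> {0..<1}" if "i \<in> {1..n}" for i using that by (intro x_range) auto
  show "x i * real (grid (Suc k)) \<in> \<int>" if "i \<in> {1..n}" for i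
    using that n by (intro x_grid) auto
  show "\<exists>i\<in>{1..n}. real c / strata k \<le> x i \<and> x i < (real c + 1) / strata k" if c: "c < strata k" for c
  proof
    have dvd: "strata k dvd 2 ^ k" unfolding strata_def by (intro le_imp_power_dvd) auto
    then have "strata k \<le> 2 ^ k" by (rule dvd_imp_le) simp
    then have i: "2 ^ k \<le> 2 ^ k + c" "2 ^ k + c < 2 ^ Suc k" using c by auto
    \<comment> \<open>\<open>2 ^ k\<close> is a multiple of \<open>strata k\<close>, so the first
      round of level \<open>k\<close> starts at stratum 0.\<close>
    have "(2 ^ k + c) mod strata k = c" using dvd c by (simp add: mod_add_left_eq[symmetric] dvd_imp_mod_0)
    then show "real c / strata k \<le> x (2 ^ k + c) \<and> x (2 ^ k + c) < (real c + 1) / strata k"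
      using x_stratum[OF i] by simp
    show "2 ^ k + c \<in> {1..n}" using i n one_le_power[of "2::nat" k] by auto
  qed
  have "2 * grid (Suc k) = 2 ^ (Suc (Suc k) + \<eta> (Suc k))" by (simp add: grid_def)
  \<comment> \<open>Comparing exponents leaves \<open>\<eta> k \<le> \<eta> (Suc k)\<close>.\<close>
  also have "\<dots> \<le> 2 ^ (2 * (\<eta> (Suc k) + 1) + (k - \<eta> k))"
    using monoD[OF \<eta>_mono, of k "Suc k"] \<eta>_le[of k] by (intro power_increasing) auto
  also have "\<dots> = 4 ^ (\<eta> (Suc k) + 1) * strata k"
    by (simp only: power_add power_mult strata_def) simp
  finally show "2 * grid (Suc k) \<le> 4 ^ (\<eta> (Suc k) + 1) * strata k" .
qed auto

end

section \<open>Choice of the slow function and conclusion\<close>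

theorem theorem1p4:
  fixes f :: "nat \<Rightarrow> nat"
  assumes f_pos: "\<forall>n\<ge>1. f n \<ge> 1"
    and f_lim: "filterlim f at_top sequentially"
  shows "\<exists>x :: nat \<Rightarrow> real.
           (\<forall>n\<ge>1. x n \<in> {0..<1}) \<and>
           poissonian_pair_correlations x \<and>
           (\<forall>\<^sub>F n in sequentially. num_gap_lengths x n \<le> f n)"
proof -
  \<comment> \<open>The first condition is the growth bound required by \<open>sum_dev_le\<close>;
    the second leaves room for \<open>4 ^ (e + 1)\<close> gap lengths from index
    \<open>2 ^ k\<close> on.\<close>
  define Q where "Q e k \<longleftrightarrow> 100 * (real k + 1)\<^sup>2 * 64 ^ e \<le> 2 ^ k \<and>
    (\<forall>n\<ge>2 ^ k. 4 ^ (e + 1) \<le> f n)" for e k :: nat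
  have Q: "\<forall>\<^sub>F k in sequentially. Q e k" for e
  proof -
    define c :: real where "c = 100 * 64 ^ e"
    have "(\<lambda>k. c * (real k + 1)\<^sup>2 / 2 ^ k) \<longlonglongrightarrow> 0" by real_asymp
    then have "\<forall>\<^sub>F k in sequentially. c * (real k + 1)\<^sup>2 / 2 ^ k < 1"
      by (rule order_tendstoD) simp
    moreover obtain n0 where n0: "\<And>n. n \<ge> n0 \<Longrightarrow> 4 ^ (e + 1) \<le> f n"
      using f_lim unfolding filterlim_at_top eventually_sequentially by meson
    have "\<forall>\<^sub>F k in sequentially. k \<ge> n0" by (rule eventually_ge_at_top)
    then have "\<forall>\<^sub>F k in sequentially. \<forall>n\<ge>2 ^ k. 4 ^ (e + 1) \<le> f n"
      by eventually_elim (meson n0 less_exp less_imp_le order_trans)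
    ultimately show ?thesis
      by eventually_elim (simp add: Q_def c_def field_simps)
  qed
  obtain \<eta> where \<eta>: "\<eta> 0 = 0" "mono \<eta>" "\<And>k. \<eta> (Suc k) \<le> Suc (\<eta> k)"
    and lim: "filterlim \<eta> at_top sequentially" and Q\<eta>: "\<forall>\<^sub>F k in sequentially. Q (\<eta> k) k"
    using slow_function_exists[of Q, OF Q] by blast
  interpret levels \<eta> by standard (use \<eta> in auto)
  obtain x where "greedy x" using greedy_exists by blast
  then interpret greedy_sequence \<eta> x by unfold_locales
  have "poissonian_pair_correlations x"
    using Q\<eta> by (intro poissonian lim) (auto simp: Q_def elim: eventually_mono)
  moreover have "\<forall>\<^sub>F n in sequentially. num_gap_lengths x n \<le> f n"
  proof -
    have "\<forall>\<^sub>F n in sequentially. Q (\<eta> (floor_log n)) (floor_log n)"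
      by (rule eventually_compose_filterlim[OF Q\<eta> filterlim_floor_log])
    then show ?thesis using eventually_ge_at_top[of 2]
    proof eventually_elim
      case (elim n)
      then obtain k where k: "2 ^ k \<le> n" "n < 2 ^ Suc k" "floor_log n = k"
        using level_exists[of n] by auto
      \<comment> \<open>\<open>n \<ge> 2\<close> makes \<open>k\<close> positive, so a complete
        level precedes it.\<close>
      then obtain l where l: "k = Suc l" using elim(2) by (cases k) auto
      have "num_gap_lengths x n \<le> 4 ^ (\<eta> k + 1)"
        using num_gap_lengths_x_le[of l n] k unfolding l by blast
      also have "\<dots> \<le> f n" using elim(1) k unfolding Q_def by blast
      finally show ?case .
    qed
  qed
  ultimately show ?thesis using x_range by blast
qed

end
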